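(* For integers $\mu,s,t\ge1$, \[ \begin{split} &2\sum_{\nu = 1}^\infty \frac{H_\nu }{\nu ^s (\nu + \mu )^t } = ( - 1)^{s - 1} \binom{s+t-2}{s-1}\frac{H_{\mu - 1}^2 + H_{\mu - 1,2} + 2\zeta (2)}{\mu ^{s + t - 1} } + \sum_{i = 0}^{s - 2} \binom{t+i-1}i\frac{( - 1)^i (s - i + 2)\zeta (s - i + 1)}{\mu ^{t + i} }\\ &\quad - \sum_{i = 0}^{s - 2} \binom{t+i-1}i\frac{( - 1)^i }{\mu ^{t + i} }\sum_{j = 1}^{s - i - 2} \zeta (j + 1)\zeta (s - i - j) + 2( - 1)^s H_{\mu - 1} \sum_{i = 0}^{t - 2} \binom{s+i-1}i\frac{\zeta (t - i) - H_{\mu - 1,t - i} }{\mu ^{s + i} }\\ &\quad + ( - 1)^s \sum_{i = 0}^{t - 2} \binom{s+i-1}i\frac{(t - i)\left( \zeta (t - i + 1) - H_{\mu - 1,t - i + 1} \right)}{\mu ^{s + i} }\\ &\quad - ( - 1)^s \sum_{i = 0}^{t - 2} \binom{s+i-1}i\frac{1}{\mu ^{s + i} }\sum_{j = 1}^{t - i - 2} \left( \zeta (j + 1) - H_{\mu - 1,j + 1} \right)\left( \zeta (t - i - j) - H_{\mu - 1,t - i - j} \right). \end{split} \]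
   Context: For integers $m\ge0$ and $n$, $H_{m,n}=\sum_{k=1}^m k^{-n}$ (with $H_{0,n}=0$) and $H_m=H_{m,1}$; $\zeta$ is the Riemann zeta function. Sums whose upper limit is below the lower limit are empty (zero). *)

theory Defs
  imports "HOL-Analysis.Analysis"
begin

(* H_{m,n} for an integer order n; H_m = H_{m,1} is the library's harm m. *)
definition gen_harm :: "nat \<Rightarrow> int \<Rightarrow> real" where
  "gen_harm m n = (\<Sum>k=1..m. real k powi (- n))"

lemma gen_harm_1: "gen_harm m 1 = harm m"
  by (simp add: gen_harm_def harm_def power_int_minus)

(* The Riemann zeta function through its Dirichlet series; meaningful for s > 1 only. *)
definition zeta :: "real \<Rightarrow> real" where
  "zeta s = (\<Sum>n. real (Suc n) powr (- s))"

end

theory Submission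
  imports Defs
begin

text \<open>
  Partial fractions in \<open>\<nu>\<close> reduce the sum to three kinds of series.

  The two simple poles have opposite residues and give
  \<open>\<Sum>\<nu>. H\<^sub>\<nu> (1 / \<nu> - 1 / (\<nu> + \<mu>))\<close>, which is evaluated by induction on \<open>\<mu>\<close>: by Abel summation,
  the increment is \<open>\<Sum>\<nu>. 1 / (\<nu> (\<nu> + \<mu>)) = H\<^sub>\<mu> / \<mu>\<close>.

  The poles of order \<open>q \<ge> 2\<close> at \<open>- \<mu>\<close> give \<open>\<Sum>\<nu>. H\<^sub>\<nu> / (\<nu> + \<mu>) ^ q\<close>, evaluated by Euler's method:
  the absolutely convergent series of \<open>1 / (k (k - n) n ^ (q - 1))\<close> over distinct \<open>n, k \<ge> \<mu>\<close> has row sums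
  \<open>(1 / n + H\<^bsub>\<mu>-1\<^esub> - H\<^bsub>n-\<mu>\<^esub>) / n ^ q\<close>, while adding its transpose turns the summand into a geometric
  sum of the products \<open>1 / (n ^ (j + 1) k ^ (q - j))\<close>, which gives products of tails of zeta values minus
  the diagonal. The poles at \<open>0\<close> reduce to the case \<open>\<mu> = 1\<close>.
\<close>

section \<open>Growth of harmonic numbers and elementary series\<close>

text \<open>The increment is at most \<open>1 / sqrt (n + 1)\<close>, which is bounded by the
  increment of \<open>2 * sqrt n\<close>. Any growth exponent below 1 would serve the two
  convergence claims that follow.\<close>

lemma harm_le_2_sqrt: "harm n \<le> 2 * sqrt (real n)"
proof (induction n)
  case (Suc n)
  define a b where "a = sqrt (real n)" and "b = sqrt (real (Suc n))"
  have ab: "0 \<le> a" "1 \<le> b" "a \<le> b" "b\<^sup>2 - a\<^sup>2 = 1"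
    by (simp_all add: a_def b_def)
  have "inverse (b\<^sup>2) \<le> inverse b"
    using ab by (intro le_imp_inverse_le) (auto simp: power2_eq_square)
  also have "inverse b \<le> 2 * (b - a)"
  proof -
    have "1 = (b - a) * (b + a)"
      using ab by (simp add: algebra_simps power2_eq_square)
    also have "\<dots> \<le> (b - a) * (2 * b)"
      using ab by (intro mult_left_mono) auto
    finally show ?thesis
      using ab by (simp add: field_simps)
  qed
  finally have "inverse (real (Suc n)) \<le> 2 * (b - a)"
    by (simp add: b_def)
  with Suc show ?case
    by (simp add: harm_Suc a_def b_def)
qed (simp add: harm_def)

text \<open>\<open>harm n / n ^ 2\<close> is the sum over \<open>k > n\<close> in row
  \<open>n\<close> of the off-diagonal double series below, whose convergence rests on this.\<close>

lemma summable_harm_over_square: "summable (\<lambda>n. harm (Suc n) / real (Suc n) ^ 2)"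
proof (rule summable_comparison_test')
  have "summable (\<lambda>n. real n powr (-3/2))"
    by (subst summable_real_powr_iff) simp
  then show "summable (\<lambda>n. 2 * real (Suc n) powr (-3/2))"
    by (subst (asm) summable_Suc_iff [symmetric]) (rule summable_mult)
  fix n :: nat
  have "real (Suc n) powr (1/2) / real (Suc n) powr 2 = real (Suc n) powr (-3/2)"
    by (subst powr_diff [symmetric]) simp
  then have "sqrt (real (Suc n)) / real (Suc n) ^ 2 = real (Suc n) powr (-3/2)"
    by (simp add: powr_half_sqrt powr_numeral del: of_nat_Suc)
  then show "norm (harm (Suc n) / real (Suc n) ^ 2) \<le> 2 * real (Suc n) powr (-3/2)"
    using harm_le_2_sqrt[of "Suc n"]
    by (simp add: divide_le_eq field_simps)
qed

text \<open>Removes the boundary term of the Abel summation.\<close>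

lemma harm_over_shift_tendsto_0: "(\<lambda>n. harm n / real (n + c)) \<longlonglongrightarrow> 0"
proof (rule Lim_null_comparison)
  have "(\<lambda>n. real n powr (-1/2)) \<longlonglongrightarrow> 0"
    by (rule tendsto_neg_powr) (auto intro: filterlim_real_sequentially)
  from tendsto_mult_right_zero[OF this, of 2]
  show "(\<lambda>n. 2 * real n powr (-1/2)) \<longlonglongrightarrow> 0" .
  show "\<forall>\<^sub>F n in sequentially. norm (harm n / real (n + c)) \<le> 2 * real n powr (-1/2)"
    using eventually_gt_at_top[of 0]
  proof eventually_elim
    case (elim n)
    have "harm n / real (n + c) \<le> 2 * sqrt (real n) / real n"
      using elim by (intro frac_le harm_le_2_sqrt) auto
    also have "\<dots> = 2 * (real n powr (1/2) / real n powr 1)"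
      using elim by (simp add: powr_half_sqrt)
    also have "real n powr (1/2) / real n powr 1 = real n powr (-1/2)"
      by (subst powr_diff [symmetric]) simp
    finally show ?case
      using harm_nonneg[of n, where 'a = real] by simp
  qed
qed

text \<open>Raising \<open>n\<close> by one adds a series that telescopes to
  \<open>1 / (n + 1)\<close>.\<close>

lemma sums_reciprocal_shift:
  "(\<lambda>k. 1 / real (Suc k) - 1 / real (Suc k + n)) sums harm n"
proof (induction n)
  case (Suc n)
  have "(\<lambda>k. 1 / real (k + Suc n)) \<longlonglongrightarrow> 0"
    by (rule LIMSEQ_ignore_initial_segment[OF lim_inverse_n'])
  from sums_add[OF Suc telescope_sums'[OF this]]
  show ?case
    by (simp add: harm_Suc inverse_eq_divide add_ac)
qed (simp add: harm_def)

lemma sums_reciprocal_prod_shift: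
  assumes "n > 0"
  shows "(\<lambda>k. 1 / (real (Suc k) * real (Suc k + n))) sums (harm n / real n)"
proof -
  have eq: "(1 / a - 1 / (a + b)) / b = 1 / (a * (a + b))" if "a > 0" "b > 0" for a b :: real
    using that by (simp add: divide_simps)
  have "(1 / real (Suc k) - 1 / real (Suc k + n)) / real n = 1 / (real (Suc k) * real (Suc k + n))" for k
    using eq[of "real (Suc k)" "real n"] assms by (simp add: add_ac)
  with sums_divide[OF sums_reciprocal_shift, of n "real n"] show ?thesis
    by simp
qed

lemma sums_zeta_nat:
  assumes "q \<ge> 2"
  shows "(\<lambda>n. 1 / real (Suc n) ^ q) sums zeta (real q)"
proof -
  have eq: "real (Suc n) powr (- real q) = 1 / real (Suc n) ^ q" for n
    by (simp add: powr_minus powr_realpow inverse_eq_divide del: of_nat_Suc)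
  have "summable (\<lambda>n. real n powr (- real q))"
    by (subst summable_real_powr_iff) (use assms in simp)
  then have "summable (\<lambda>n. real (Suc n) powr (- real q))"
    by (subst (asm) summable_Suc_iff [symmetric])
  then show ?thesis
    unfolding zeta_def eq by (rule summable_sums)
qed

section \<open>Abel summation and the two simple poles\<close>

lemma sum_shift_abel:
  fixes h b :: "nat \<Rightarrow> 'a::comm_ring"
  shows "(\<Sum>k<n. (\<Sum>j\<le>k. h j) * (b k - b (Suc k))) = (\<Sum>k<n. h k * b k) - (\<Sum>k<n. h k) * b n"
proof (induction n)
  case (Suc n)
  have "(\<Sum>j\<le>n. h j) = (\<Sum>j<n. h j) + h n"
    by (simp flip: lessThan_Suc_atMost)
  with Suc show ?case
    by (simp add: algebra_simps)
qed simp

text \<open>Summation by parts moves the difference onto \<open>harm\<close>, whose increments are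
  \<open>1 / (k + 1)\<close>. The value \<open>c\<close> is a parameter because it is
  \<open>zeta 2\<close> for \<open>n = 0\<close> but \<open>harm n / n\<close> for
  \<open>n > 0\<close>.\<close>

lemma sums_harm_times_difference:
  assumes "(\<lambda>k. 1 / (real (Suc k) * real (Suc k + n))) sums c"
  shows "(\<lambda>k. harm (Suc k) * (1 / real (Suc k + n) - 1 / real (Suc k + Suc n))) sums c"
proof -
  define h b where "h = (\<lambda>k. inverse (real (Suc k)))" and "b = (\<lambda>k. 1 / real (Suc k + n))"
  have harm: "harm k = (\<Sum>j<k. h j)" for k
    by (simp add: harm_altdef h_def)
  have "(\<lambda>k. harm k * b k) \<longlonglongrightarrow> 0"
    using harm_over_shift_tendsto_0[of "Suc n"] by (simp add: b_def)
  with assms have "(\<lambda>k. (\<Sum>j<k. h j * b j) - harm k * b k) \<longlonglongrightarrow> c - 0"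
    unfolding sums_def h_def b_def
    by (intro tendsto_diff) (simp_all add: inverse_eq_divide)
  also have "(\<lambda>k. (\<Sum>j<k. h j * b j) - harm k * b k)
      = (\<lambda>k. \<Sum>j<k. harm (Suc j) * (b j - b (Suc j)))"
    unfolding harm lessThan_Suc_atMost sum_shift_abel ..
  finally show ?thesis
    by (simp add: sums_def b_def)
qed

lemma sums_harm_reciprocal_difference:
  "(\<lambda>k. harm (Suc k) * (1 / real (Suc k) - 1 / real (Suc k + Suc n)))
     sums (((harm n)\<^sup>2 + gen_harm n 2 + 2 * zeta 2) / 2)"
proof (induction n)
  case 0
  have "(\<lambda>k. 1 / (real (Suc k) * real (Suc k + 0))) sums zeta 2"
    using sums_zeta_nat[of 2] by (simp add: power2_eq_square)
  from sums_harm_times_difference[OF this] show ?case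
    by (simp add: harm_def gen_harm_def)
next
  case (Suc n)
  have gh: "gen_harm (Suc n) 2 = gen_harm n 2 + 1 / (real (Suc n))\<^sup>2"
    by (simp add: gen_harm_def power_int_minus inverse_eq_divide)
  \<comment> \<open>The square grows by \<open>2 * harm n / (n + 1) + 1 / (n + 1)^2\<close> and
    \<open>gen_harm\<close> by another \<open>1 / (n + 1)^2\<close>; half of the total is
    \<open>harm (n + 1) / (n + 1)\<close>.\<close>
  have eq: "((harm n)\<^sup>2 + gen_harm n 2 + 2 * zeta 2) / 2 + harm (Suc n) / real (Suc n)
     = ((harm (Suc n))\<^sup>2 + gen_harm (Suc n) 2 + 2 * zeta 2) / 2"
    unfolding gh harm_Suc inverse_eq_divide
    by (simp add: add_divide_distrib algebra_simps power2_eq_square del: of_nat_Suc)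
  show ?case
    using sums_add[OF Suc sums_harm_times_difference[OF sums_reciprocal_prod_shift[of "Suc n"]]]
    unfolding eq by (simp add: algebra_simps)
qed

section \<open>Partial fractions\<close>

text \<open>The principal part of \<open>1 / (x ^ s * (x + c) ^ t)\<close> at \<open>x = 0\<close>; the one at \<open>x = - c\<close> is
  obtained by exchanging \<open>s\<close> with \<open>t\<close> and \<open>c\<close> with \<open>- c\<close>. For \<open>t = 0\<close> the truncated
  subtraction still gives the right binomial coefficient at \<open>i = 0\<close>.\<close>

definition pf_part :: "nat \<Rightarrow> nat \<Rightarrow> real \<Rightarrow> real \<Rightarrow> real" where
  "pf_part s t c x = (\<Sum>i<s. real ((t + i - 1) choose i) * (-1) ^ i / (c ^ (t + i) * x ^ (s - i)))"

text \<open>Mirrors \<open>1 / (x * (x + c)) = (1 / x - 1 / (x + c)) / c\<close>, multiplied by the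
  remaining powers, at the level of principal parts.\<close>

lemma pf_part_Suc_Suc:
  assumes "c \<noteq> 0"
  shows "pf_part (Suc s) (Suc t) c x = (pf_part (Suc s) t c x - pf_part s (Suc t) c x) / c"
proof -
  define w where "w = (\<lambda>i. (-1) ^ i / (c ^ (t + i) * x ^ (Suc s - i)))"
  have "pf_part (Suc s) (Suc t) c x = (\<Sum>i<Suc s. real ((t + i) choose i) * w i) / c"
    using assms by (simp add: pf_part_def w_def sum_divide_distrib add_divide_distrib mult_ac)
  moreover have "pf_part (Suc s) t c x = (\<Sum>i<Suc s. real ((t + i - 1) choose i) * w i)"
    by (simp add: pf_part_def w_def)
  moreover have "pf_part s (Suc t) c x = - (\<Sum>i<s. real ((t + i) choose i) * w (Suc i))"
    by (simp add: pf_part_def w_def sum_negf)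
  \<comment> \<open>Pascal's rule for the terms of index \<open>Suc i\<close>; at index 0 both
    binomial coefficients are 1.\<close>
  moreover have "(\<Sum>i<Suc s. real ((t + i) choose i) * w i) =
      (\<Sum>i<Suc s. real ((t + i - 1) choose i) * w i) + (\<Sum>i<s. real ((t + i) choose i) * w (Suc i))"
    unfolding sum.lessThan_Suc_shift by (simp add: sum.distrib algebra_simps)
  ultimately show ?thesis
    by simp
qed

lemma pf_part_0_right:
  assumes "s > 0"
  shows "pf_part s 0 c x = 1 / x ^ s"
proof -
  from assms obtain r where s: "s = Suc r"
    using gr0_conv_Suc by blast
  show ?thesis
    unfolding pf_part_def s sum.lessThan_Suc_shift by (simp add: binomial_eq_0)
qed

lemma partial_fractions:
  assumes "x \<noteq> 0" "x + c \<noteq> 0" "c \<noteq> 0" "s + t > 0"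
  shows "1 / (x ^ s * (x + c) ^ t) = pf_part s t c x + pf_part t s (- c) (x + c)"
  using assms(4)
proof (induction "s + t" arbitrary: s t rule: less_induct)
  case less
  consider "s = 0" | "t = 0" | u v where "s = Suc u" "t = Suc v"
    using not0_implies_Suc by blast
  then show ?case
  proof cases
    case 3
    have 1: "1 / (x ^ Suc u * (x + c) ^ v) = pf_part (Suc u) v c x + pf_part v (Suc u) (- c) (x + c)"
      and 2: "1 / (x ^ u * (x + c) ^ Suc v) = pf_part u (Suc v) c x + pf_part (Suc v) u (- c) (x + c)"
      using less.hyps[of "Suc u" v] less.hyps[of u "Suc v"] 3 by simp_all
    have "1 / (x ^ s * (x + c) ^ t)
        = (1 / (x ^ Suc u * (x + c) ^ v) - 1 / (x ^ u * (x + c) ^ Suc v)) / c"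
      using assms 3 by (simp add: divide_simps)
    \<comment> \<open>For the part at the other pole, the sign from dividing by \<open>- c\<close>
      matches the exchange of the two exponents.\<close>
    also have "\<dots> = pf_part s t c x + pf_part t s (- c) (x + c)"
      unfolding 1 2 3 using assms(3) by (simp add: pf_part_Suc_Suc add_divide_distrib diff_divide_distrib)
    finally show ?thesis .
  qed (use less.prems in \<open>auto simp: pf_part_0_right\<close>, simp_all add: pf_part_def)
qed


section \<open>Tails of zeta values and rows of the double series\<close>

lemma has_sum_zeta_tail:
  assumes "q \<ge> 2"
  shows "((\<lambda>n. 1 / real n ^ q) has_sum (zeta (real q) - gen_harm m (int q))) {m<..}"
proof -
  have "((\<lambda>n. 1 / real (Suc n) ^ q) has_sum zeta (real q)) UNIV"
    using sums_zeta_nat[OF assms] by (rule sums_nonneg_imp_has_sum) simp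
  also have "?this \<longleftrightarrow> ((\<lambda>n. 1 / real n ^ q) has_sum zeta (real q)) {0<..}"
    by (rule has_sum_reindex_bij_witness[of _ "\<lambda>n. n - 1" Suc]) auto
  finally have "((\<lambda>n. 1 / real n ^ q) has_sum (zeta (real q) - (\<Sum>n=1..m. 1 / real n ^ q))) ({0<..} - {1..m})"
    by (rule has_sum_Diff) auto
  moreover have "{0<..} - {1..m} = {m<..}"
    by auto
  moreover have "(\<Sum>n=1..m. 1 / real n ^ q) = gen_harm m (int q)"
    unfolding gen_harm_def by (intro sum.cong) (simp_all add: power_int_minus inverse_eq_divide)
  ultimately show ?thesis
    by simp
qed

lemma has_sum_reciprocal_prod_greater:
  assumes "n > 0"
  shows "((\<lambda>k. 1 / (real k * (real k - real n))) has_sum (harm n / real n)) {n<..}"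
proof -
  have "((\<lambda>k. 1 / (real (Suc k) * real (Suc k + n))) has_sum (harm n / real n)) UNIV"
    using sums_reciprocal_prod_shift[OF assms] by (rule sums_nonneg_imp_has_sum) simp
  also have "?this \<longleftrightarrow> ?thesis"
    by (rule has_sum_reindex_bij_witness[of _ "\<lambda>k. k - Suc n" "\<lambda>k. Suc k + n"]) (auto simp: mult_ac)
  finally show ?thesis .
qed

lemma sum_reciprocal_prod_less:
  assumes "m < n"
  shows "(\<Sum>k\<in>{m<..<n}. 1 / (real k * (real k - real n)))
           = (1 / real n + harm m - harm n - harm (n - Suc m)) / real n"
proof -
  have "(\<Sum>k\<in>{m<..<n}. 1 / (real k * (real k - real n)))
      = (\<Sum>k\<in>{m<..<n}. (- inverse (real (n - k)) - inverse (real k)) / real n)"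
    using assms by (intro sum.cong) (auto simp: divide_simps of_nat_diff)
  also have "\<dots> = (- (\<Sum>k\<in>{m<..<n}. inverse (real (n - k))) - (\<Sum>k\<in>{m<..<n}. inverse (real k))) / real n"
    unfolding sum_subtractf [symmetric] sum_negf [symmetric] sum_divide_distrib ..
  also have "(\<Sum>k\<in>{m<..<n}. inverse (real (n - k))) = harm (n - Suc m)"
    unfolding harm_def
    by (rule sum.reindex_bij_witness[of _ "\<lambda>k. n - k" "\<lambda>k. n - k"]) auto
  also have "(\<Sum>k\<in>{m<..<n}. inverse (real k)) = harm n - harm m - 1 / real n"
  proof -
    have "{1..n} = {1..m} \<union> insert n {m<..<n}"
      using assms by auto
    then have "harm n = harm m + (\<Sum>k\<in>insert n {m<..<n}. inverse (real k))"
      unfolding harm_def by (simp only:) (rule sum.union_disjoint; use assms in auto)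
    then show ?thesis
      by (simp add: inverse_eq_divide)
  qed
  finally show ?thesis
    by (simp add: algebra_simps)
qed

text \<open>The two \<open>harm n\<close> terms, from \<open>k < n\<close> and from
  \<open>k > n\<close>, cancel.\<close>

lemma has_sum_reciprocal_prod_neq:
  assumes "m < n"
  shows "((\<lambda>k. 1 / (real k * (real k - real n))) has_sum
           ((1 / real n + harm m - harm (n - Suc m)) / real n)) ({m<..} - {n})"
proof -
  have "((\<lambda>k. 1 / (real k * (real k - real n))) has_sum
      ((1 / real n + harm m - harm n - harm (n - Suc m)) / real n + harm n / real n)) ({m<..<n} \<union> {n<..})"
    using assms
    by (intro has_sum_Un_disjoint has_sum_finiteI has_sum_reciprocal_prod_greater)
       (auto simp: sum_reciprocal_prod_less)
  moreover have "{m<..<n} \<union> {n<..} = {m<..} - {n}"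
    using assms by auto
  ultimately show ?thesis
    by (simp add: diff_divide_distrib add_divide_distrib algebra_simps)
qed

text \<open>The summand is nonnegative and symmetric, so it suffices to treat the half
  \<open>k > n\<close>, whose row sums \<open>harm n / n ^ 2\<close> are summable.\<close>

lemma summable_on_off_diagonal:
  "(\<lambda>(n,k). 1 / (real n * real k * \<bar>real k - real n\<bar>)) summable_on (SIGMA n:{0<..}. {0<..} - {n})"
    (is "?f summable_on ?D")
proof -
  define U :: "(nat \<times> nat) set" where "U = (SIGMA n:{0<..}. {n<..})"
  define V :: "(nat \<times> nat) set" where "V = {(n,k). 0 < k \<and> k < n}"
  have "(\<lambda>n. harm (Suc n) / real (Suc n) ^ 2) summable_on UNIV"
    using summable_harm_over_square
    by (intro summable_nonneg_imp_summable_on) (auto intro!: divide_nonneg_nonneg harm_nonneg)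
  also have "?this \<longleftrightarrow> (\<lambda>n. harm n / real n ^ 2 :: real) summable_on {0<..}"
    by (rule summable_on_reindex_bij_witness[of _ "\<lambda>n. n - 1" Suc]) auto
  finally have "?f summable_on U"
    unfolding U_def
  proof (rule summable_on_SigmaI[rotated])
    fix n :: nat assume "n \<in> {0<..}"
    then have "((\<lambda>k. 1 / real n * (1 / (real k * (real k - real n)))) has_sum (1 / real n * (harm n / real n))) {n<..}"
      by (intro has_sum_cmult_right has_sum_reciprocal_prod_greater) simp
    then show "((\<lambda>k. case (n, k) of (n, k) \<Rightarrow> 1 / (real n * real k * \<bar>real k - real n\<bar>))
        has_sum (harm n / real n ^ 2)) {n<..}"
      by (subst has_sum_cong[where g = "\<lambda>k. 1 / real n * (1 / (real k * (real k - real n)))"])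
         (auto simp: power2_eq_square)
  qed auto
  also have "?this \<longleftrightarrow> ?f summable_on V"
    by (rule summable_on_reindex_bij_witness[of _ prod.swap prod.swap])
       (auto simp: U_def V_def abs_minus_commute mult_ac)
  finally have "?f summable_on U \<union> V"
    using \<open>?f summable_on U\<close> by (intro summable_on_union)
  then show ?thesis
    by (rule summable_on_subset) (auto simp: U_def V_def)
qed

section \<open>Euler's method: symmetrizing the double series\<close>

text \<open>The left side is \<open>(1 / x ^ p - 1 / y ^ p) / (x * y * (y - x))\<close>, a geometric
  sum in \<open>1 / x\<close> and \<open>1 / y\<close>; the pole at \<open>x = y\<close>
  disappears.\<close>

lemma power_difference_quotient:
  fixes x y :: real
  assumes "x \<noteq> 0" "y \<noteq> 0" "x \<noteq> y"
  shows "1 / (y * (y - x) * x ^ (p + 1)) + 1 / (x * (x - y) * y ^ (p + 1))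
           = (\<Sum>j=1..p. 1 / x ^ (j + 1) * (1 / y ^ (p + 2 - j)))"
proof (induction p)
  case 0
  show ?case
    using assms by (simp add: divide_simps)
next
  case (Suc p)
  have "(\<Sum>j=1..Suc p. 1 / x ^ (j + 1) * (1 / y ^ (Suc p + 2 - j)))
      = (\<Sum>j=1..p. 1 / x ^ (j + 1) * (1 / y ^ (p + 2 - j))) / y + 1 / x ^ (p + 2) * (1 / y ^ 2)"
    by (simp add: sum_divide_distrib Suc_diff_le power2_eq_square mult_ac)
  also have "\<dots> = (1 / (y * (y - x) * x ^ (p + 1)) + 1 / (x * (x - y) * y ^ (p + 1))) / y
      + 1 / x ^ (p + 2) * (1 / y ^ 2)"
    unfolding Suc ..
  also have "\<dots> = 1 / (y * (y - x) * x ^ (Suc p + 1)) + 1 / (x * (x - y) * y ^ (Suc p + 1))"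
    using assms by (simp add: divide_simps) (simp add: algebra_simps power2_eq_square)
  finally show ?case ..
qed

lemma has_sum_product_nonneg:
  fixes f :: "'a \<Rightarrow> real" and g :: "'b \<Rightarrow> real"
  assumes "(f has_sum a) A" "(g has_sum b) B"
    "\<And>x. x \<in> A \<Longrightarrow> f x \<ge> 0" "\<And>x. x \<in> B \<Longrightarrow> g x \<ge> 0"
  shows "((\<lambda>(x,y). f x * g y) has_sum (a * b)) (A \<times> B)"
proof (rule has_sum_SigmaI)
  show "((\<lambda>x. f x * b) has_sum (a * b)) A"
    using assms(1) by (rule has_sum_cmult_left)
  show *: "((\<lambda>y. case (x, y) of (x, y) \<Rightarrow> f x * g y) has_sum (f x * b)) B" for x
    using has_sum_cmult_right[OF assms(2)] by simp
  show "(\<lambda>(x,y). f x * g y) summable_on A \<times> B"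
    using has_sum_cmult_left[OF assms(1), of b] assms(3,4)
    by (intro summable_on_SigmaI[OF *]) (auto simp: summable_on_def)
qed



lemma has_sum_sum:
  fixes f :: "'i \<Rightarrow> 'a \<Rightarrow> 'b::topological_comm_monoid_add"
  assumes "finite I" "\<And>i. i \<in> I \<Longrightarrow> (f i has_sum S i) A"
  shows "((\<lambda>x. \<Sum>i\<in>I. f i x) has_sum (\<Sum>i\<in>I. S i)) A"
  using assms by (induction I rule: finite_induct) (auto intro!: has_sum_add)

lemma sums_harm_over_shift_power:
  fixes m q :: nat
  assumes "q \<ge> 2"
  defines "Z \<equiv> (\<lambda>r::nat. zeta (real r) - gen_harm m (int r))"
  shows "(\<lambda>\<nu>. harm \<nu> / real (\<nu> + Suc m) ^ q) sums
    ((2 * harm m * Z q + real q * Z (q + 1) - (\<Sum>j=1..q - 2. Z (j + 1) * Z (q - j))) / 2)"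
proof -
  define p where "p = q - 2"
  have q: "q = p + 2"
    using assms by (simp add: p_def)
  define A where "A = {m<..}"
  define D where "D = (SIGMA n:A. A - {n})"
  define g where "g = (\<lambda>(n,k). 1 / (real k * (real k - real n) * real n ^ (p + 1)))"
  \<comment> \<open>\<open>h\<close> is the symmetrization of \<open>g\<close>; unlike \<open>g\<close>, it extends to the diagonal.\<close>
  define h where "h = (\<lambda>(n,k). \<Sum>j=1..p. 1 / real n ^ (j + 1) * (1 / real k ^ (p + 2 - j)))"
  define W where "W = (\<Sum>j=1..p. Z (j + 1) * Z (p + 2 - j))"
  have Z: "((\<lambda>n. 1 / real n ^ r) has_sum Z r) A" if "r \<ge> 2" for r
    unfolding Z_def A_def using that by (rule has_sum_zeta_tail)

  \<comment> \<open>Absolute convergence, by comparison with the case \<open>p = 0\<close>, permits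
    both summation by rows and the exchange of \<open>n\<close> and \<open>k\<close>.\<close>
  have "(\<lambda>x. norm (g x)) summable_on D"
  proof (rule Infinite_Sum.abs_summable_on_comparison_test')
    show "(\<lambda>(n,k). 1 / (real n * real k * \<bar>real k - real n\<bar>)) summable_on D"
      by (rule summable_on_subset[OF summable_on_off_diagonal]) (auto simp: D_def A_def)
    fix x assume "x \<in> D"
    then obtain n k where x: "x = (n, k)" and nk: "0 < n" "0 < k" "n \<noteq> k"
      by (auto simp: D_def A_def)
    have "real n ^ 1 \<le> real n ^ (p + 1)"
      using nk by (intro power_increasing) auto
    then have "1 / (real k * \<bar>real k - real n\<bar> * real n ^ (p + 1)) \<le> 1 / (real k * \<bar>real k - real n\<bar> * real n)"
      using nk by (intro divide_left_mono mult_left_mono mult_pos_pos) auto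
    then show "norm (g x) \<le> (case x of (n, k) \<Rightarrow> 1 / (real n * real k * \<bar>real k - real n\<bar>))"
      by (simp add: x g_def abs_mult mult_ac)
  qed
  then have "g summable_on D"
    by (rule abs_summable_summable)
  then obtain G where G: "(g has_sum G) D"
    by (auto simp: summable_on_def)

  have "((\<lambda>n. (1 / real n + harm m - harm (n - Suc m)) / real n / real n ^ (p + 1)) has_sum G) A"
    using G unfolding D_def
  proof (rule has_sum_SigmaD)
    fix n assume "n \<in> A"
    then have "((\<lambda>k. 1 / (real k * (real k - real n)) * (1 / real n ^ (p + 1))) has_sum
        ((1 / real n + harm m - harm (n - Suc m)) / real n * (1 / real n ^ (p + 1)))) (A - {n})"
      unfolding A_def by (intro has_sum_cmult_left has_sum_reciprocal_prod_neq) simp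
    then show "((\<lambda>k. g (n, k)) has_sum (1 / real n + harm m - harm (n - Suc m)) / real n / real n ^ (p + 1)) (A - {n})"
      by (simp add: g_def)
  qed
  \<comment> \<open>Solves the row sums for \<open>harm (n - Suc m) / n ^ q\<close>; the
    substitution \<open>n = \<nu> + Suc m\<close> then yields the required series.\<close>
  from has_sum_add[OF has_sum_add[OF Z[of "q + 1"] has_sum_cmult_right[OF Z[of q], of "harm m"]] has_sum_uminusI[OF this]]
  have "((\<lambda>n. 1 / real n ^ (q + 1) + harm m * (1 / real n ^ q)
          - (1 / real n + harm m - harm (n - Suc m)) / real n / real n ^ (p + 1))
        has_sum (Z (q + 1) + harm m * Z q - G)) A"
    using assms by simp
  also have "?this \<longleftrightarrow> ((\<lambda>\<nu>. harm \<nu> / real (\<nu> + Suc m) ^ q) has_sum (Z (q + 1) + harm m * Z q - G)) UNIV"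
    by (rule has_sum_reindex_bij_witness[of _ "\<lambda>\<nu>. \<nu> + Suc m" "\<lambda>n. n - Suc m"])
       (auto simp: A_def q field_simps)
  finally have main: "(\<lambda>\<nu>. harm \<nu> / real (\<nu> + Suc m) ^ q) sums (Z (q + 1) + harm m * Z q - G)"
    by (rule has_sum_imp_sums)

  have "((\<lambda>x. g (prod.swap x)) has_sum G) D \<longleftrightarrow> (g has_sum G) D"
    by (rule has_sum_reindex_bij_witness[of _ prod.swap prod.swap]) (auto simp: D_def)
  with G have "((\<lambda>x. g x + g (prod.swap x)) has_sum (G + G)) D"
    by (intro has_sum_add) simp_all
  also have "?this \<longleftrightarrow> (h has_sum (G + G)) D"
  proof (rule has_sum_cong)
    fix x assume "x \<in> D"
    then obtain n k where x: "x = (n, k)" and nk: "0 < n" "0 < k" "n \<noteq> k"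
      by (auto simp: D_def A_def)
    then show "g x + g (prod.swap x) = h x"
      using power_difference_quotient[of "real n" "real k" p] by (simp only: g_def h_def x) simp
  qed
  finally have h1: "(h has_sum (G + G)) D" .

  have "((\<lambda>x. \<Sum>j=1..p. (\<lambda>(n,k). 1 / real n ^ (j + 1) * (1 / real k ^ (p + 2 - j))) x) has_sum W) (A \<times> A)"
    unfolding W_def by (intro has_sum_sum has_sum_product_nonneg Z) auto
  then have hAA: "(h has_sum W) (A \<times> A)"
    by (simp add: h_def case_prod_unfold)
  \<comment> \<open>On the diagonal each of the \<open>p\<close> summands of \<open>h\<close> equals
    \<open>1 / n ^ (q + 1)\<close>.\<close>
  have "((\<lambda>n. real p * (1 / real n ^ (q + 1))) has_sum (real p * Z (q + 1))) A"
    by (intro has_sum_cmult_right Z) (simp add: q)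
  also have "?this \<longleftrightarrow> (h has_sum (real p * Z (q + 1))) ((\<lambda>n. (n, n)) ` A)"
  proof (subst has_sum_reindex)
    have "(\<Sum>j=1..p. 1 / real n ^ (j + 1) * (1 / real n ^ (p + 2 - j))) = (\<Sum>j=1..p. 1 / real n ^ (q + 1))" for n
      by (intro sum.cong) (auto simp: q simp flip: power_add power_Suc)
    then show "((\<lambda>n. real p * (1 / real n ^ (q + 1))) has_sum real p * Z (q + 1)) A \<longleftrightarrow>
        (h \<circ> (\<lambda>n. (n, n)) has_sum real p * Z (q + 1)) A"
      by (simp add: h_def o_def)
  qed (auto simp: inj_on_def)
  finally have "(h has_sum (W - real p * Z (q + 1))) (A \<times> A - (\<lambda>n. (n, n)) ` A)"
    using hAA by (intro has_sum_Diff) auto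
  moreover have "A \<times> A - (\<lambda>n. (n, n)) ` A = D"
    by (auto simp: D_def)
  ultimately have "G + G = W - real p * Z (q + 1)"
    using h1 has_sum_unique by metis
  \<comment> \<open>After doubling, \<open>Z (q + 1)\<close> occurs twice directly and
    \<open>p\<close> times through the diagonal, hence the coefficient \<open>q\<close>.\<close>
  then have "Z (q + 1) + harm m * Z q - G =
      (2 * harm m * Z q + real q * Z (q + 1) - (\<Sum>j=1..q - 2. Z (j + 1) * Z (q - j))) / 2"
    by (simp add: W_def q field_simps)
  with main show ?thesis
    by (simp only:)
qed

text \<open>The case \<open>m = 0\<close> has \<open>harm \<nu>\<close> over a power of
  \<open>\<nu> + 1\<close>; passing to \<open>harm (Suc \<nu>)\<close> adds
  \<open>zeta (q + 1)\<close>, which turns the coefficient \<open>q\<close> into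
  \<open>q + 2\<close>.\<close>

lemma sums_harm_over_power:
  assumes "q \<ge> 2"
  shows "(\<lambda>\<nu>. harm (Suc \<nu>) / real (Suc \<nu>) ^ q) sums
    ((real (q + 2) * zeta (real (q + 1)) - (\<Sum>j=1..q - 2. zeta (real (j + 1)) * zeta (real (q - j)))) / 2)"
proof -
  have "harm (Suc \<nu>) / real (Suc \<nu>) ^ q = harm \<nu> / real (\<nu> + Suc 0) ^ q + 1 / real (Suc \<nu>) ^ (q + 1)" for \<nu>
    by (simp add: harm_Suc inverse_eq_divide add_divide_distrib)
  moreover have "q + 1 \<ge> 2"
    using assms by simp
  ultimately show ?thesis
    using sums_add[OF sums_harm_over_shift_power[OF assms, of 0] sums_zeta_nat[of "q + 1"]]
    by (simp add: gen_harm_def harm_def[of 0] algebra_simps add_divide_distrib diff_divide_distrib)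
qed

section \<open>Splitting off the simple poles and assembling the formula\<close>

text \<open>The simple pole is isolated because its series diverges on its own and has to be paired
  with the one at the other pole.\<close>

lemma pf_part_Suc:
  "pf_part (Suc s) t c x = (\<Sum>i<s. real ((t + i - 1) choose i) * (-1) ^ i / c ^ (t + i) * (1 / x ^ (Suc s - i)))
     + real ((t + s - 1) choose s) * (-1) ^ s / c ^ (t + s) * (1 / x)"
  by (simp add: pf_part_def)

theorem theorem5p5:
  fixes \<mu> s t :: nat
  assumes "\<mu> \<ge> 1" and "s \<ge> 1" and "t \<ge> 1"
  defines "f \<equiv> (\<lambda>\<nu>::nat. harm \<nu> / (real \<nu> ^ s * real (\<nu> + \<mu>) ^ t))"
  shows "summable (\<lambda>n. f (Suc n)) \<and>
    2 * (\<Sum>n. f (Suc n)) =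
      (-1) ^ (s - 1) * real ((s + t - 2) choose (s - 1)) *
        ((harm (\<mu> - 1))\<^sup>2 + gen_harm (\<mu> - 1) 2 + 2 * zeta 2) / real \<mu> ^ (s + t - 1)
    + (\<Sum>i\<in>{0..<s - 1}. real ((t + i - 1) choose i) *
        ((-1) ^ i * real (s - i + 2) * zeta (real (s - i + 1))) / real \<mu> ^ (t + i))
    - (\<Sum>i\<in>{0..<s - 1}. real ((t + i - 1) choose i) * ((-1) ^ i / real \<mu> ^ (t + i)) *
        (\<Sum>j=1..s - i - 2. zeta (real (j + 1)) * zeta (real (s - i - j))))
    + 2 * (-1) ^ s * harm (\<mu> - 1) *
        (\<Sum>i\<in>{0..<t - 1}. real ((s + i - 1) choose i) *
          ((zeta (real (t - i)) - gen_harm (\<mu> - 1) (int (t - i))) / real \<mu> ^ (s + i)))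
    + (-1) ^ s *
        (\<Sum>i\<in>{0..<t - 1}. real ((s + i - 1) choose i) *
          (real (t - i) * (zeta (real (t - i + 1)) - gen_harm (\<mu> - 1) (int (t - i + 1)))
            / real \<mu> ^ (s + i)))
    - (-1) ^ s *
        (\<Sum>i\<in>{0..<t - 1}. real ((s + i - 1) choose i) * (1 / real \<mu> ^ (s + i)) *
          (\<Sum>j=1..t - i - 2.
            (zeta (real (j + 1)) - gen_harm (\<mu> - 1) (int (j + 1))) *
            (zeta (real (t - i - j)) - gen_harm (\<mu> - 1) (int (t - i - j)))))"
proof -
  obtain m u v where m: "\<mu> = Suc m" and u: "s = Suc u" and v: "t = Suc v"
    using assms by (metis Suc_le_D One_nat_def)
  define Z where "Z = (\<lambda>r::nat. zeta (real r) - gen_harm m (int r))"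
  \<comment> \<open>\<open>E\<close>, \<open>T\<close> and \<open>L\<close> are twice the values of
    the three kinds of series, in line with the factor 2 in the claim; \<open>c\<close> is the
    residue at 0.\<close>
  define E where "E = (\<lambda>q::nat. real (q + 2) * zeta (real (q + 1)) - (\<Sum>j=1..q - 2. zeta (real (j + 1)) * zeta (real (q - j))))"
  define T where "T = (\<lambda>q::nat. 2 * harm m * Z q + real q * Z (q + 1) - (\<Sum>j=1..q - 2. Z (j + 1) * Z (q - j)))"
  define L where "L = (harm m)\<^sup>2 + gen_harm m 2 + 2 * zeta 2"
  define c where "c = real ((u + v) choose u) * (-1) ^ u / real \<mu> ^ (s + v)"
  define a where "a = (\<lambda>i. real ((t + i - 1) choose i) * (-1) ^ i / real \<mu> ^ (t + i))"
  define b where "b = (\<lambda>i. real ((s + i - 1) choose i) * ((-1) ^ s / real \<mu> ^ (s + i)))"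
  have f: "f (Suc n) = (\<Sum>i<u. a i * (harm (Suc n) / real (Suc n) ^ (s - i)))
      + (\<Sum>i<v. b i * (harm (Suc n) / real (Suc n + \<mu>) ^ (t - i)))
      + c * (harm (Suc n) * (1 / real (Suc n) - 1 / real (Suc n + \<mu>)))" for n
  proof -
    define x where "x = real (Suc n)"
    define y where "y = real (Suc n + \<mu>)"
    have y: "y = x + real \<mu>" and "x \<noteq> 0" "y \<noteq> 0"
      by (simp_all add: x_def y_def)
    then have "1 / (x ^ s * y ^ t) = pf_part s t (real \<mu>) x + pf_part t s (- real \<mu>) y"
      using partial_fractions[of x "real \<mu>" s t] assms by simp
    also have "pf_part s t (real \<mu>) x = (\<Sum>i<u. a i * (1 / x ^ (s - i))) + c * (1 / x)"
      unfolding u pf_part_Suc by (simp add: a_def c_def u v add_ac)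
    also have "pf_part t s (- real \<mu>) y = (\<Sum>i<v. b i * (1 / y ^ (t - i))) - c * (1 / y)"
    proof -
      \<comment> \<open>The sign no longer depends on \<open>i\<close>. At \<open>i = v\<close> the
        factor \<open>(-1) ^ s\<close> is opposite to the \<open>(-1) ^ u\<close> in
        \<open>c\<close>, so the residue at \<open>- \<mu>\<close> is \<open>- c\<close>.\<close>
      have "(-1) ^ i / (- real \<mu>) ^ (s + i) = (-1) ^ s / real \<mu> ^ (s + i)" for i
        by (simp add: uminus_power_if)
      moreover have "((s + v - 1) choose v) = ((u + v) choose u)"
        using binomial_symmetric[of u "u + v"] by (simp add: u)
      ultimately show ?thesis
        unfolding v pf_part_Suc by (simp add: b_def c_def u flip: times_divide_eq_right)
    qed
    finally have "harm (Suc n) * (1 / (x ^ s * y ^ t)) = harm (Suc n) *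
        ((\<Sum>i<u. a i * (1 / x ^ (s - i))) + c * (1 / x)
          + ((\<Sum>i<v. b i * (1 / y ^ (t - i))) - c * (1 / y)))"
      by (simp only:)
    then show ?thesis
      unfolding f_def x_def [symmetric] y_def [symmetric]
      by (simp add: algebra_simps sum_distrib_left)
  qed
  have zero: "(\<lambda>n. harm (Suc n) / real (Suc n) ^ q) sums (E q / 2)" if "q \<ge> 2" for q
    unfolding E_def using that by (rule sums_harm_over_power)
  have shift: "(\<lambda>n. harm (Suc n) / real (Suc n + \<mu>) ^ q) sums (T q / 2)" if "q \<ge> 2" for q
  proof -
    \<comment> \<open>The index may start at 1 instead of 0 because
      \<open>harm 0 = 0\<close>.\<close>
    have "(\<lambda>n. harm n / real (n + \<mu>) ^ q) sums (T q / 2 + harm 0 / real (0 + \<mu>) ^ q)"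
      using sums_harm_over_shift_power[OF that, of m] unfolding T_def Z_def m by (simp add: harm_def[of 0])
    then show ?thesis
      by (subst sums_Suc_iff)
  qed
  have "(\<lambda>n. f (Suc n)) sums ((\<Sum>i<u. a i * (E (s - i) / 2)) + (\<Sum>i<v. b i * (T (t - i) / 2)) + c * (L / 2))"
    unfolding f
    using sums_harm_reciprocal_difference[of m, folded m L_def]
    \<comment> \<open>For \<open>i < u\<close> and \<open>i < v\<close> respectively, the exponents
      \<open>s - i\<close> and \<open>t - i\<close> are at least 2, as \<open>zero\<close> and
      \<open>shift\<close> require.\<close>
    by (intro sums_add sums_sum sums_mult zero shift) (auto simp: u v)
  then have "summable (\<lambda>n. f (Suc n))" and
    eq: "2 * (\<Sum>n. f (Suc n)) = (\<Sum>i<u. a i * E (s - i)) + (\<Sum>i<v. b i * T (t - i)) + c * L"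
    by (auto simp: sums_iff sum_distrib_left algebra_simps)
  moreover have "(\<Sum>i<u. a i * E (s - i)) =
      (\<Sum>i\<in>{0..<s - 1}. real ((t + i - 1) choose i) *
        ((-1) ^ i * real (s - i + 2) * zeta (real (s - i + 1))) / real \<mu> ^ (t + i))
    - (\<Sum>i\<in>{0..<s - 1}. real ((t + i - 1) choose i) * ((-1) ^ i / real \<mu> ^ (t + i)) *
        (\<Sum>j=1..s - i - 2. zeta (real (j + 1)) * zeta (real (s - i - j))))"
    unfolding sum_subtractf [symmetric] E_def a_def
    by (intro sum.cong) (auto simp: u right_diff_distrib)
  moreover have "(\<Sum>i<v. b i * T (t - i)) =
      2 * (-1) ^ s * harm m * (\<Sum>i\<in>{0..<t - 1}. real ((s + i - 1) choose i) * (Z (t - i) / real \<mu> ^ (s + i)))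
    + (-1) ^ s * (\<Sum>i\<in>{0..<t - 1}. real ((s + i - 1) choose i) *
          (real (t - i) * Z (t - i + 1) / real \<mu> ^ (s + i)))
    - (-1) ^ s * (\<Sum>i\<in>{0..<t - 1}. real ((s + i - 1) choose i) * (1 / real \<mu> ^ (s + i)) *
          (\<Sum>j=1..t - i - 2. Z (j + 1) * Z (t - i - j)))"
    unfolding sum_subtractf [symmetric] sum.distrib [symmetric] sum_distrib_left[of _ _ "{0..<t - 1}"] T_def b_def
    by (intro sum.cong) (auto simp: v right_diff_distrib distrib_left mult_ac)
  moreover have "c * L = (-1) ^ (s - 1) * real ((s + t - 2) choose (s - 1)) *
        ((harm m)\<^sup>2 + gen_harm m 2 + 2 * zeta 2) / real \<mu> ^ (s + t - 1)"
    by (simp add: c_def L_def u v)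
  moreover have "\<mu> - 1 = m"
    by (simp add: m)
  ultimately show ?thesis
    unfolding Z_def by simp
qed


end
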